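(* Let $1<p<\infty$ and let $X$ be an unbounded proper connected metric space equipped with a locally doubling measure $\mu$ supporting a local $p$-Poincaré inequality. If $X\notin O^p_{HD}$, i.e. if there is a nonconstant $p$-harmonic function on $X$ with finite energy, then $D^p(X)\ne N^{1,p}(X)+\mathbf{R}$, where $N^{1,p}(X)+\mathbf{R}=\{f+c: f\in N^{1,p}(X),\ c\in\mathbf{R}\}$.
   Context: Setting. $(X,d)$ is a metric space equipped with a positive complete Borel measure $\mu$ with $0<\mu(B)<\infty$ for all balls $B=B(x,r)=\{y:d(x,y)<r\}$; $\lambda B=B(x,\lambda r)$. $X$ is proper if every closed bounded set is compact. $\mu$ is doubling within a ball $B_0$ if there is $C>0$ (depending on $B_0$) with $\mu(2B)\le C\mu(B)$ for all balls $B\subset B_0$. The $p$-Poincaré inequality holds within $B_0$ if there are $C>0$, $\lambda\ge1$ (depending on $B_0$) such that for all balls $B\subset B_0$ of radius $r_B$, all integrable $u$ on $\lambda B$ and all upper gradients $g$ of $u$ in $\lambda B$, $\frac1{\mu(B)}\int_B|u-u_B|\,d\mu\le C r_B\bigl(\frac1{\mu(\lambda B)}\int_{\lambda B}g^p\,d\mu\bigr)^{1/p}$, where $u_B=\frac1{\mu(B)}\int_Bu\,d\mu$. Each property is local if every $x\in X$ has some $r>0$ such that it holds within $B(x,r)$. Curves are nonconstant, compact and rectifiable, parameterized by arc length. The $p$-modulus of a curve family $\Gamma$ is $\mathrm{Mod}_p(\Gamma)=\inf_\rho\int_X\rho^p\,d\mu$, over all nonnegative Borel $\rho$ with $\int_\gamma\rho\,ds\ge1$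 for all $\gamma\in\Gamma$. A nonnegative Borel function $g$ is an upper gradient of $u:X\to[-\infty,\infty]$ if $|u(\gamma(0))-u(\gamma(l_\gamma))|\le\int_\gamma g\,ds$ for all curves $\gamma:[0,l_\gamma]\to X$ (left-hand side $=\infty$ if a term is infinite); a nonnegative measurable $g$ is a $p$-weak upper gradient if this holds for all curves except for a family of zero $p$-modulus. If $u$ has an upper gradient in $L^p_{\rm loc}$, $g_u$ denotes its minimal $p$-weak upper gradient (minimal a.e. among all $p$-weak upper gradients in $L^p_{\rm loc}$). $N^{1,p}(X)$ is the set of measurable $u:X\to[-\infty,\infty]$ with $\int_X|u|^p\,d\mu+\inf_g\int_Xg^p\,d\mu<\infty$ (inf over upper gradients $g$ of $u$); $D^p(X)$ is the set of measurable functions on $X$ having an upper gradient in $L^p(X)$. $N^{1,p}_{\rm loc}(X)$: every $x\in X$ has $r_x>0$ with $u\in N^{1,p}(B(x,r_x))$. A $p$-harmonic function on $X$ is a continuous $u\in N^{1,p}_{\rm loc}(X)$ with $\int_{\{\varphi\ne0\}}g_u^p\,d\mu\le\int_{\{\varphi\ne0\}}g_{u+\varphi}^p\,d\mu$ for all $\varphi\in N^{1,p}(X)$. Finite energy means $\int_Xg_u^p\,d\mu<\infty$. $X\in O^p_{HD}$ if every $p$-harmonic function on $X$ with finite energy is constant. *)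

theory Defs
  imports "HOL-Analysis.Analysis"
begin

text \<open>
  The metric space \<open>X\<close> is the type \<^typ>\<open>'a::metric_space\<close>. Functions \<open>X \<rightarrow> [-\<infinity>,\<infinity>]\<close> have values in
  \<^typ>\<open>ereal\<close>, nonnegative functions and gradients have values in \<^typ>\<open>ennreal\<close> (that is, \<open>[0,\<infinity>]\<close>).
  A ball is given by a centre and a radius. For function spaces and upper gradients on an open
  subset \<open>\<Omega>\<close>, functions are total and only their values on \<open>\<Omega>\<close> matter.
\<close>

definition epow :: "real \<Rightarrow> ennreal \<Rightarrow> ennreal" where
  "epow p x = (if x = \<infinity> then \<infinity> else ennreal (enn2real x powr p))"

subsection \<open>The measure and the standing assumptions\<close>

definition complete_borel_measure :: "'a::metric_space measure \<Rightarrow> bool" where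
  "complete_borel_measure M \<longleftrightarrow> (\<exists>N. sets N = sets borel \<and> M = completion N)"

definition proper_space :: "'a::metric_space itself \<Rightarrow> bool" where
  "proper_space _ \<longleftrightarrow> (\<forall>S::'a set. closed S \<and> bounded S \<longrightarrow> compact S)"

definition doubling_within :: "'a::metric_space measure \<Rightarrow> 'a set \<Rightarrow> bool" where
  "doubling_within M B0 \<longleftrightarrow>
     (\<exists>C>0::real. \<forall>x. \<forall>r>0. ball x r \<subseteq> B0 \<longrightarrow>
        emeasure M (ball x (2 * r)) \<le> ennreal C * emeasure M (ball x r))"

definition locally_doubling :: "'a::metric_space measure \<Rightarrow> bool" where
  "locally_doubling M \<longleftrightarrow> (\<forall>x. \<exists>r>0. doubling_within M (ball x r))"

subsection \<open>Curves and upper gradients\<close>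

definition curve_length :: "(real \<Rightarrow> 'a::metric_space) \<Rightarrow> real \<Rightarrow> real \<Rightarrow> ennreal" where
  "curve_length \<gamma> a b =
     (SUP ts \<in> {ts. sorted ts \<and> set ts \<subseteq> {a..b}}.
        \<Sum>i<length ts - 1. ennreal (dist (\<gamma> (ts ! i)) (\<gamma> (ts ! Suc i))))"

text \<open>
  A pair \<open>(\<gamma>, l)\<close> represents the curve \<open>\<gamma>\<close> restricted to \<open>[0,l]\<close>. Parameterization by arc length
  entails that the curve is continuous (even 1-Lipschitz) and of length \<open>l\<close>, so that
  \<open>0 < l\<close> says exactly that it is nonconstant.
\<close>

definition arc_length_curve :: "(real \<Rightarrow> 'a::metric_space) \<Rightarrow> real \<Rightarrow> bool" where
  "arc_length_curve \<gamma> l \<longleftrightarrow>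
     0 < l \<and> (\<forall>s t. 0 \<le> s \<and> s \<le> t \<and> t \<le> l \<longrightarrow> curve_length \<gamma> s t = ennreal (t - s))"

definition curve_integral :: "('a::metric_space \<Rightarrow> ennreal) \<Rightarrow> (real \<Rightarrow> 'a) \<Rightarrow> real \<Rightarrow> ennreal" where
  "curve_integral g \<gamma> l = (\<integral>\<^sup>+t. g (\<gamma> t) \<partial>lebesgue_on {0..l})"

text \<open>
  In \<^typ>\<open>ereal\<close>, \<open>\<bar>a - b\<bar> = \<infinity>\<close> as soon as one of \<open>a\<close>, \<open>b\<close> is infinite (also for \<open>\<infinity> - \<infinity>\<close>), which is
  the convention for the left-hand side of the upper gradient inequality.
\<close>

definition upper_gradient_ineq ::
    "('a::metric_space \<Rightarrow> ereal) \<Rightarrow> ('a \<Rightarrow> ennreal) \<Rightarrow> (real \<Rightarrow> 'a) \<Rightarrow> real \<Rightarrow> bool" where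
  "upper_gradient_ineq u g \<gamma> l \<longleftrightarrow>
     e2ennreal \<bar>u (\<gamma> 0) - u (\<gamma> l)\<bar> \<le> curve_integral g \<gamma> l"

lemma ereal_abs_diff_infinite:
  fixes a b :: ereal
  assumes "\<bar>a\<bar> = \<infinity> \<or> \<bar>b\<bar> = \<infinity>"
  shows "\<bar>a - b\<bar> = \<infinity>"
  using assms by (cases a; cases b) auto

definition upper_gradient_on ::
    "'a::metric_space set \<Rightarrow> ('a \<Rightarrow> ereal) \<Rightarrow> ('a \<Rightarrow> ennreal) \<Rightarrow> bool" where
  "upper_gradient_on \<Omega> u g \<longleftrightarrow>
     g \<in> borel_measurable (restrict_space borel \<Omega>) \<and>
     (\<forall>\<gamma> l. arc_length_curve \<gamma> l \<and> \<gamma> ` {0..l} \<subseteq> \<Omega> \<longrightarrow> upper_gradient_ineq u g \<gamma> l)"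

definition p_modulus ::
    "'a::metric_space measure \<Rightarrow> real \<Rightarrow> ((real \<Rightarrow> 'a) \<times> real) set \<Rightarrow> ennreal" where
  "p_modulus M p \<Gamma> =
     (INF \<rho> \<in> {\<rho>. \<rho> \<in> borel_measurable borel \<and> (\<forall>(\<gamma>, l)\<in>\<Gamma>. 1 \<le> curve_integral \<rho> \<gamma> l)}.
        \<integral>\<^sup>+x. epow p (\<rho> x) \<partial>M)"

text \<open>
  For a \<open>\<mu>\<close>-measurable \<open>g\<close> the integral along a curve need not be defined; the definition of a
  \<open>p\<close>-weak upper gradient includes that it is defined along all nonexceptional curves.
\<close>

definition p_weak_upper_gradient ::
    "'a::metric_space measure \<Rightarrow> real \<Rightarrow> ('a \<Rightarrow> ereal) \<Rightarrow> ('a \<Rightarrow> ennreal) \<Rightarrow> bool" where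
  "p_weak_upper_gradient M p u g \<longleftrightarrow>
     g \<in> borel_measurable M \<and>
     (\<exists>\<Gamma>. p_modulus M p \<Gamma> = 0 \<and>
        (\<forall>\<gamma> l. arc_length_curve \<gamma> l \<and> (\<gamma>, l) \<notin> \<Gamma> \<longrightarrow>
           (\<lambda>t. g (\<gamma> t)) \<in> borel_measurable (lebesgue_on {0..l}) \<and> upper_gradient_ineq u g \<gamma> l))"

definition Lp_loc :: "'a::metric_space measure \<Rightarrow> real \<Rightarrow> ('a \<Rightarrow> ennreal) \<Rightarrow> bool" where
  "Lp_loc M p g \<longleftrightarrow>
     g \<in> borel_measurable M \<and> (\<forall>x. \<exists>r>0. (\<integral>\<^sup>+y\<in>ball x r. epow p (g y) \<partial>M) < \<infinity>)"

text \<open>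
  The minimal \<open>p\<close>-weak upper gradient \<open>g\<^sub>u\<close> is determined only up to a.e. equality, so it is
  rendered as a relation: \<open>g\<close> is a version of \<open>g\<^sub>u\<close>.
\<close>

definition minimal_p_weak_upper_gradient ::
    "'a::metric_space measure \<Rightarrow> real \<Rightarrow> ('a \<Rightarrow> ereal) \<Rightarrow> ('a \<Rightarrow> ennreal) \<Rightarrow> bool" where
  "minimal_p_weak_upper_gradient M p u g \<longleftrightarrow>
     p_weak_upper_gradient M p u g \<and> Lp_loc M p g \<and>
     (\<forall>h. p_weak_upper_gradient M p u h \<and> Lp_loc M p h \<longrightarrow> (AE x in M. g x \<le> h x))"

definition poincare_within :: "'a::metric_space measure \<Rightarrow> real \<Rightarrow> 'a set \<Rightarrow> bool" where
  "poincare_within M p B0 \<longleftrightarrow>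
     (\<exists>C>0::real. \<exists>L\<ge>1::real. \<forall>x. \<forall>r>0. ball x r \<subseteq> B0 \<longrightarrow>
        (\<forall>u g. u \<in> borel_measurable (restrict_space M (ball x (L * r))) \<and>
           (\<integral>\<^sup>+y\<in>ball x (L * r). e2ennreal \<bar>u y\<bar> \<partial>M) < \<infinity> \<and>
           upper_gradient_on (ball x (L * r)) u g \<longrightarrow>
           (let uB = (LINT y:ball x r|M. real_of_ereal (u y)) / measure M (ball x r) in
            (\<integral>\<^sup>+y\<in>ball x r. e2ennreal \<bar>u y - ereal uB\<bar> \<partial>M) / emeasure M (ball x r)
            \<le> ennreal (C * r) *
              epow (1 / p) ((\<integral>\<^sup>+y\<in>ball x (L * r). epow p (g y) \<partial>M)
                             / emeasure M (ball x (L * r))))))"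

definition local_poincare :: "'a::metric_space measure \<Rightarrow> real \<Rightarrow> bool" where
  "local_poincare M p \<longleftrightarrow> (\<forall>x. \<exists>r>0. poincare_within M p (ball x r))"

subsection \<open>Function spaces\<close>

definition N1p_on :: "'a::metric_space measure \<Rightarrow> real \<Rightarrow> 'a set \<Rightarrow> ('a \<Rightarrow> ereal) set" where
  "N1p_on M p \<Omega> = {u. u \<in> borel_measurable (restrict_space M \<Omega>) \<and>
     (\<integral>\<^sup>+x\<in>\<Omega>. epow p (e2ennreal \<bar>u x\<bar>) \<partial>M)
       + (INF g \<in> {g. upper_gradient_on \<Omega> u g}. \<integral>\<^sup>+x\<in>\<Omega>. epow p (g x) \<partial>M) < \<infinity>}"

abbreviation N1p :: "'a::metric_space measure \<Rightarrow> real \<Rightarrow> ('a \<Rightarrow> ereal) set" where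
  "N1p M p \<equiv> N1p_on M p UNIV"

definition N1p_loc :: "'a::metric_space measure \<Rightarrow> real \<Rightarrow> ('a \<Rightarrow> ereal) set" where
  "N1p_loc M p = {u. \<forall>x. \<exists>r>0. u \<in> N1p_on M p (ball x r)}"

definition Dp :: "'a::metric_space measure \<Rightarrow> real \<Rightarrow> ('a \<Rightarrow> ereal) set" where
  "Dp M p = {u. u \<in> borel_measurable M \<and>
     (\<exists>g. upper_gradient_on UNIV u g \<and> (\<integral>\<^sup>+x. epow p (g x) \<partial>M) < \<infinity>)}"

subsection \<open>Harmonic functions\<close>

text \<open>
  Every \<open>u \<in> N1p_loc\<close> has a minimal \<open>p\<close>-weak upper gradient and any two versions agree a.e., so the
  quantification over versions \<open>g\<close> of \<open>g\<^sub>u\<close> and \<open>h\<close> of \<open>g\<^bsub>u+\<phi>\<^esub>\<close> below is over representatives of one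
  class each; similarly for the energy. Since \<open>u\<close> is real-valued, \<open>u + \<phi>\<close> is always defined.
\<close>

definition p_harmonic :: "'a::metric_space measure \<Rightarrow> real \<Rightarrow> ('a \<Rightarrow> real) \<Rightarrow> bool" where
  "p_harmonic M p u \<longleftrightarrow>
     continuous_on UNIV u \<and> (\<lambda>x. ereal (u x)) \<in> N1p_loc M p \<and>
     (\<forall>\<phi>\<in>N1p M p. \<forall>g h.
        minimal_p_weak_upper_gradient M p (\<lambda>x. ereal (u x)) g \<and>
        minimal_p_weak_upper_gradient M p (\<lambda>x. ereal (u x) + \<phi> x) h \<longrightarrow>
        (\<integral>\<^sup>+x\<in>{x. \<phi> x \<noteq> 0}. epow p (g x) \<partial>M) \<le> (\<integral>\<^sup>+x\<in>{x. \<phi> x \<noteq> 0}. epow p (h x) \<partial>M))"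

definition finite_energy :: "'a::metric_space measure \<Rightarrow> real \<Rightarrow> ('a \<Rightarrow> real) \<Rightarrow> bool" where
  "finite_energy M p u \<longleftrightarrow>
     (\<exists>g. minimal_p_weak_upper_gradient M p (\<lambda>x. ereal (u x)) g \<and> (\<integral>\<^sup>+x. epow p (g x) \<partial>M) < \<infinity>)"

definition O_HD :: "'a::metric_space measure \<Rightarrow> real \<Rightarrow> bool" where
  "O_HD M p \<longleftrightarrow> (\<forall>u. p_harmonic M p u \<and> finite_energy M p u \<longrightarrow> (\<exists>c. \<forall>x. u x = c))"

end

theory Submission
  imports Defs
begin

text \<open>
  If \<open>D\<^sup>p = N\<^sup>1\<^sup>,\<^sup>p + \<real>\<close>, a \<open>p\<close>-harmonic \<open>u\<close> of finite energy is \<open>f + c\<close> with \<open>f \<in> N\<^sup>1\<^sup>,\<^sup>p\<close>. Testing harmonicity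
  with \<open>\<phi> = -f\<close>, for which \<open>u + \<phi> = c\<close>, gives \<open>g\<^sub>u = 0\<close> a.e. on \<open>{u \<noteq> c}\<close>. Since \<open>u\<close> is continuous,
  a curve along which \<open>u\<close> is not constant has a piece on which \<open>u \<noteq> c\<close> and whose end values differ,
  so the curves with \<open>u(\<gamma>(0)) \<noteq> u(\<gamma>(l))\<close> have zero modulus and \<open>u\<close> has upper gradients of
  arbitrarily small norm. The Poincare inequality makes \<open>u\<close> locally constant, hence constant.
\<close>

section \<open>Powers with a real exponent on the extended half-line\<close>

lemma epow_0 [simp]: "epow p 0 = 0"
  by (simp add: epow_def)

lemma epow_mono:
  assumes "0 \<le> p" "x \<le> y"
  shows "epow p x \<le> epow p y"
proof (cases "y = \<infinity>")
  case False
  then have "x \<noteq> \<infinity>" using assms(2) by (auto simp: top_unique)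
  moreover have "enn2real x \<le> enn2real y"
    using False assms(2) by (intro enn2real_mono) (auto simp: top.not_eq_extremum)
  ultimately show ?thesis
    using False assms(1) by (auto simp: epow_def intro!: ennreal_leI powr_mono2)
qed (simp add: epow_def)

text \<open>Below, gradients are combined by \<open>max\<close> rather than by a sum, so that
  energies add without a convexity constant.\<close>

lemma epow_max_le:
  assumes "0 \<le> p"
  shows "epow p (max x y) \<le> epow p x + epow p y"
  by (cases "x \<le> y") (auto simp: max_def intro: add_increasing add_increasing2)

lemma epow_epow_inverse:
  assumes "0 < p"
  shows "epow p (epow (1 / p) x) = x"
proof (cases "x = \<infinity>")
  case False
  then obtain r where "x = ennreal r" "0 \<le> r" by (cases x) auto
  then show ?thesis using assms by (auto simp: epow_def powr_powr)
qed (simp add: epow_def)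

lemma epow_inverse_epow:
  assumes "0 < p"
  shows "epow (1 / p) (epow p x) = x"
  using epow_epow_inverse[of "1 / p" x] assms by simp

lemma epow_cmult:
  assumes "0 < p" "0 \<le> c"
  shows "epow p (ennreal c * x) = ennreal (c powr p) * epow p x"
proof (cases "c = 0 \<or> x = \<infinity>")
  case True
  then show ?thesis using assms
    by (auto simp: epow_def ennreal_mult_eq_top_iff ennreal_mult_top)
next
  case False
  then obtain r where r: "x = ennreal r" "0 \<le> r" by (cases x) auto
  then show ?thesis using assms by (simp add: epow_def powr_mult flip: ennreal_mult)
qed

lemma epow_eq_0_iff: "0 < p \<Longrightarrow> epow p x = 0 \<longleftrightarrow> x = 0"
  by (metis epow_0 epow_inverse_epow)

lemma borel_measurable_epow [measurable]: "epow p \<in> borel_measurable borel"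
  unfolding epow_def by measurable

section \<open>Arc-length curves, their subcurves and integrals along them\<close>

lemma dist_le_curve_length:
  assumes "s \<le> t"
  shows "ennreal (dist (\<gamma> s) (\<gamma> t)) \<le> curve_length \<gamma> s t"
  unfolding curve_length_def
  using assms by (intro SUP_upper2[of "[s, t]"]) auto

lemma arc_length_curve_dist_le:
  assumes "arc_length_curve \<gamma> l" "0 \<le> s" "s \<le> t" "t \<le> l"
  shows "dist (\<gamma> s) (\<gamma> t) \<le> t - s"
proof -
  have "ennreal (dist (\<gamma> s) (\<gamma> t)) \<le> ennreal (t - s)"
    using dist_le_curve_length[OF assms(3), of \<gamma>] assms by (simp add: arc_length_curve_def)
  then show ?thesis using assms by simp
qed

lemma arc_length_curve_continuous_on:
  assumes "arc_length_curve \<gamma> l"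
  shows "continuous_on {0..l} \<gamma>"
proof -
  have "dist (\<gamma> s) (\<gamma> t) \<le> dist s t" if "s \<in> {0..l}" "t \<in> {0..l}" for s t
    using arc_length_curve_dist_le[OF assms, of s t] arc_length_curve_dist_le[OF assms, of t s] that
    by (cases "s \<le> t") (auto simp: dist_real_def dist_commute)
  then show ?thesis
    unfolding continuous_on_iff by (meson le_less_trans)
qed

text \<open>Translation by \<open>a\<close> carries a partition of one interval to a partition of
  the other with the same sum. Equality follows by applying this inequality again to the shifted
  curve with \<open>- a\<close>.\<close>

lemma curve_length_shift_le:
  "curve_length (\<lambda>r. \<gamma> (a + r)) s t \<le> curve_length \<gamma> (a + s) (a + t)"
  unfolding curve_length_def
proof (rule SUP_mono)
  fix ts :: "real list"
  assume "ts \<in> {ts. sorted ts \<and> set ts \<subseteq> {s..t}}"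
  then have "map ((+) a) ts \<in> {ts. sorted ts \<and> set ts \<subseteq> {a + s..a + t}}"
    by (auto simp: sorted_iff_nth_mono)
  moreover have "(\<Sum>i<length ts - 1. ennreal (dist (\<gamma> (a + ts ! i)) (\<gamma> (a + ts ! Suc i))))
      = (\<Sum>i<length (map ((+) a) ts) - 1.
          ennreal (dist (\<gamma> (map ((+) a) ts ! i)) (\<gamma> (map ((+) a) ts ! Suc i))))"
    by (intro sum.cong) auto
  ultimately show "\<exists>us\<in>{ts. sorted ts \<and> set ts \<subseteq> {a + s..a + t}}.
      (\<Sum>i<length ts - 1. ennreal (dist (\<gamma> (a + ts ! i)) (\<gamma> (a + ts ! Suc i))))
      \<le> (\<Sum>i<length us - 1. ennreal (dist (\<gamma> (us ! i)) (\<gamma> (us ! Suc i))))"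
    by (intro bexI[of _ "map ((+) a) ts"]) (simp_all only: order_refl)
qed

lemma curve_length_shift:
  "curve_length (\<lambda>r. \<gamma> (a + r)) s t = curve_length \<gamma> (a + s) (a + t)"
  using curve_length_shift_le[of \<gamma> a s t]
    curve_length_shift_le[of "\<lambda>r. \<gamma> (a + r)" "- a" "a + s" "a + t"]
  by (simp add: antisym)

lemma arc_length_curve_subcurve:
  assumes "arc_length_curve \<gamma> l" "0 \<le> a" "a < b" "b \<le> l"
  shows "arc_length_curve (\<lambda>r. \<gamma> (a + r)) (b - a)"
  using assms by (auto simp: arc_length_curve_def curve_length_shift)

lemma curve_integral_mono:
  assumes "\<And>x. f x \<le> g x"
  shows "curve_integral f \<gamma> l \<le> curve_integral g \<gamma> l"
  unfolding curve_integral_def using assms by (intro nn_integral_mono) auto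

text \<open>Borel measurability of \<open>\<rho>\<close> matters: a function that is only measurable
  for the completed measure may compose with a curve to something nonmeasurable. Hence the passage
  to Borel majorants below.\<close>

lemma borel_measurable_along_curve:
  assumes "arc_length_curve \<gamma> l" "\<rho> \<in> borel_measurable borel"
  shows "(\<lambda>t. \<rho> (\<gamma> t)) \<in> borel_measurable (lebesgue_on {0..l})"
proof -
  have "\<gamma> \<in> borel_measurable (restrict_space borel {0..l})"
    by (rule borel_measurable_continuous_on_restrict[OF arc_length_curve_continuous_on[OF assms(1)]])
  moreover have "sets (restrict_space borel {0..l}) \<subseteq> sets (lebesgue_on {0..l})"
    by (auto simp: sets_restrict_space)
  ultimately have "\<gamma> \<in> borel_measurable (lebesgue_on {0..l})"
    by (auto simp: measurable_def space_restrict_space)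
  then show ?thesis using assms(2) by simp
qed

text \<open>After extending the integrand by zero to the whole line, this is translation invariance
  of Lebesgue measure together with monotonicity.\<close>

lemma curve_integral_subcurve_le:
  assumes "arc_length_curve \<gamma> l" "\<rho> \<in> borel_measurable borel" "0 \<le> a" "a < b" "b \<le> l"
  shows "curve_integral \<rho> (\<lambda>r. \<gamma> (a + r)) (b - a) \<le> curve_integral \<rho> \<gamma> l"
proof -
  let ?F = "\<lambda>t. \<rho> (\<gamma> t) * indicator {0..l} t"
  have F: "?F \<in> borel_measurable lebesgue"
    using borel_measurable_along_curve[OF assms(1,2)]
    by (subst (asm) borel_measurable_restrict_space_iff_ennreal) auto
  have "curve_integral \<rho> (\<lambda>r. \<gamma> (a + r)) (b - a)
      = (\<integral>\<^sup>+r. \<rho> (\<gamma> (a + r)) * indicator {0..b - a} r \<partial>lebesgue)"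
    unfolding curve_integral_def by (subst nn_integral_restrict_space) auto
  also have "\<dots> \<le> (\<integral>\<^sup>+r. ?F (a + r) \<partial>lebesgue)"
    using assms by (intro nn_integral_mono) (auto split: split_indicator)
  also have "\<dots> = (\<integral>\<^sup>+t. ?F t \<partial>lebesgue)"
    using nn_integral_real_affine_lebesgue[OF F, of 1 a] by simp
  also have "\<dots> = curve_integral \<rho> \<gamma> l"
    unfolding curve_integral_def by (subst nn_integral_restrict_space) auto
  finally show ?thesis .
qed

section \<open>Exceptional curve families and Borel majorants\<close>

text \<open>One direction of Fuglede's description of families of zero modulus: a single weight of
  small energy is infinite along every exceptional curve. Admissible weights are combined by an
  \<open>l^p\<close> sum, so that the energies simply add and Minkowski's inequality is
  avoided.\<close>

lemma p_modulus_0_weight: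
  fixes M :: "'a::metric_space measure"
  assumes M: "sets borel \<subseteq> sets M" "space M = UNIV"
    and "0 < p" "p_modulus M p \<Gamma> = 0" "0 < \<epsilon>"
  obtains \<rho> where "\<rho> \<in> borel_measurable borel" "(\<integral>\<^sup>+x. epow p (\<rho> x) \<partial>M) \<le> ennreal \<epsilon>"
    "\<And>\<gamma> l. (\<gamma>, l) \<in> \<Gamma> \<Longrightarrow> arc_length_curve \<gamma> l \<Longrightarrow> curve_integral \<rho> \<gamma> l = \<infinity>"
proof -
  \<comment> \<open>The divisor cancels the factor that arises when \<open>\<rho> n\<close> is
    multiplied by \<open>Suc n\<close>; the geometric factors then sum to
    \<open>\<epsilon>\<close>.\<close>
  have "\<exists>\<rho>. \<rho> \<in> borel_measurable borel \<and> (\<forall>(\<gamma>, l)\<in>\<Gamma>. 1 \<le> curve_integral \<rho> \<gamma> l)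
     \<and> (\<integral>\<^sup>+x. epow p (\<rho> x) \<partial>M) < ennreal (\<epsilon> * (1/2) ^ Suc n / real (Suc n) powr p)" for n
  proof -
    have "p_modulus M p \<Gamma> < ennreal (\<epsilon> * (1/2) ^ Suc n / real (Suc n) powr p)"
      using assms by simp
    then show ?thesis unfolding p_modulus_def INF_less_iff by blast
  qed
  then obtain \<rho> where b [measurable]: "\<And>n. \<rho> n \<in> borel_measurable borel"
    and adm: "\<And>n \<gamma> l. (\<gamma>, l) \<in> \<Gamma> \<Longrightarrow> 1 \<le> curve_integral (\<rho> n) \<gamma> l"
    and int: "\<And>n. (\<integral>\<^sup>+x. epow p (\<rho> n x) \<partial>M) < ennreal (\<epsilon> * (1/2) ^ Suc n / real (Suc n) powr p)"
    by (simp add: case_prod_unfold) (metis fst_conv snd_conv)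
  \<comment> \<open>\<open>\<rho>s\<close> dominates every \<open>(n + 1) \<rho> n\<close>, so its integral along the curves of \<open>\<Gamma>\<close> is infinite.\<close>
  define \<rho>s where
    "\<rho>s x = epow (1 / p) (\<Sum>n. epow p (ennreal (real (Suc n)) * \<rho> n x))" for x
  have bs: "\<rho>s \<in> borel_measurable borel"
    unfolding \<rho>s_def by measurable
  have bM: "\<rho> n \<in> borel_measurable M" for n
    using b[of n] M by (auto simp: measurable_def)
  have ge: "ennreal (real (Suc n)) * \<rho> n x \<le> \<rho>s x" for n x
  proof -
    have "ennreal (real (Suc n)) * \<rho> n x = epow (1 / p) (epow p (ennreal (real (Suc n)) * \<rho> n x))"
      using assms by (simp add: epow_inverse_epow)
    also have "\<dots> \<le> \<rho>s x"
      unfolding \<rho>s_def using assms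
      by (intro epow_mono order_trans[OF _ sum_le_suminf[of _ "{n}"]]) auto
    finally show ?thesis .
  qed
  have "(\<integral>\<^sup>+x. epow p (\<rho>s x) \<partial>M)
      = (\<integral>\<^sup>+x. (\<Sum>n. epow p (ennreal (real (Suc n)) * \<rho> n x)) \<partial>M)"
    unfolding \<rho>s_def using assms by (simp add: epow_epow_inverse)
  also have "\<dots> = (\<Sum>n. \<integral>\<^sup>+x. epow p (ennreal (real (Suc n)) * \<rho> n x) \<partial>M)"
    using bM by (intro nn_integral_suminf) simp
  also have "\<dots> \<le> (\<Sum>n. ennreal (\<epsilon> * (1/2) ^ Suc n))"
  proof (intro suminf_le)
    fix n
    have "(\<integral>\<^sup>+x. epow p (ennreal (real (Suc n)) * \<rho> n x) \<partial>M)
        = ennreal (real (Suc n) powr p) * (\<integral>\<^sup>+x. epow p (\<rho> n x) \<partial>M)"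
      using bM assms by (subst epow_cmult) (auto simp: nn_integral_cmult)
    also have "\<dots> \<le> ennreal (real (Suc n) powr p)
        * ennreal (\<epsilon> * (1/2) ^ Suc n / real (Suc n) powr p)"
      using int[of n] by (intro mult_left_mono) auto
    also have "\<dots> = ennreal (\<epsilon> * (1/2) ^ Suc n)"
      using assms by (subst ennreal_mult[symmetric]) auto
    finally show "(\<integral>\<^sup>+x. epow p (ennreal (real (Suc n)) * \<rho> n x) \<partial>M)
        \<le> ennreal (\<epsilon> * (1/2) ^ Suc n)" .
  qed auto
  also have "\<dots> = ennreal \<epsilon>"
    using sums_mult[OF power_half_series, of \<epsilon>] assms
    by (intro suminf_ennreal_eq) auto
  finally have "(\<integral>\<^sup>+x. epow p (\<rho>s x) \<partial>M) \<le> ennreal \<epsilon>" .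
  moreover have "curve_integral \<rho>s \<gamma> l = \<infinity>" if "(\<gamma>, l) \<in> \<Gamma>" "arc_length_curve \<gamma> l" for \<gamma> l
  proof -
    have "ennreal (real (Suc n)) \<le> curve_integral \<rho>s \<gamma> l" for n
    proof -
      have "ennreal (real (Suc n)) * 1 \<le> ennreal (real (Suc n)) * curve_integral (\<rho> n) \<gamma> l"
        using adm[OF that(1)] by (intro mult_left_mono) auto
      also have "\<dots> = curve_integral (\<lambda>x. ennreal (real (Suc n)) * \<rho> n x) \<gamma> l"
        unfolding curve_integral_def
        by (rule nn_integral_cmult[symmetric, OF borel_measurable_along_curve[OF that(2) b]])
      also have "\<dots> \<le> curve_integral \<rho>s \<gamma> l"
        by (rule curve_integral_mono) (rule ge)
      finally show ?thesis by simp
    qed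
    then have "of_nat (Suc n) \<le> curve_integral \<rho>s \<gamma> l" for n
      by (simp only: ennreal_of_nat_eq_real_of_nat)
    then have "of_nat n \<le> curve_integral \<rho>s \<gamma> l" for n
      by (rule order_trans[rotated, of "of_nat (Suc n)"]) simp
    then show ?thesis
      by (metis ennreal_Ex_less_of_nat infinity_ennreal_def less_top not_less)
  qed
  ultimately show ?thesis using bs that by blast
qed

text \<open>An a.e. equal Borel version is not enough, since a curve may run inside a null set.
  Setting the version to \<open>\<infinity>\<close> on a measurable null set containing all
  disagreements makes it a majorant everywhere, so curve integrals can only grow.\<close>

lemma completion_borel_majorant:
  fixes g :: "'a \<Rightarrow> ennreal"
  assumes "g \<in> borel_measurable (completion N)"
  obtains g' where "g' \<in> borel_measurable N" "\<And>x. x \<in> space N \<Longrightarrow> g x \<le> g' x"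
    "AE x in completion N. g x = g' x"
proof -
  obtain g0 where [measurable]: "g0 \<in> borel_measurable N" and ae: "AE x in N. g x = g0 x"
    using completion_ex_borel_measurable[OF assms] by blast
  obtain E where E [measurable]: "E \<in> sets N" "emeasure N E = 0" "{x \<in> space N. g x \<noteq> g0 x} \<subseteq> E"
    using ae by (rule AE_E)
  define g' where "g' x = (if x \<in> E then \<infinity> else g0 x)" for x
  have "g' \<in> borel_measurable N" unfolding g'_def by measurable
  moreover have "g x \<le> g' x" if "x \<in> space N" for x
    using E(3) that by (auto simp: g'_def)
  moreover have "AE x in completion N. g x = g' x"
    using ae AE_not_in[of E N] E
    by (intro AE_completion) (auto simp: g'_def null_sets_def)
  ultimately show ?thesis using that by blast
qed

lemma complete_borel_measureD:
  assumes "complete_borel_measure M"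
  shows "sets borel \<subseteq> sets M" "space M = UNIV"
    and "\<And>f. f \<in> borel_measurable borel \<Longrightarrow> f \<in> borel_measurable M"
    and "\<And>g :: _ \<Rightarrow> ennreal. g \<in> borel_measurable M \<Longrightarrow>
      \<exists>g'. g' \<in> borel_measurable borel \<and> (\<forall>x. g x \<le> g' x) \<and> (AE x in M. g x = g' x)"
proof -
  obtain N where N: "sets N = sets borel" "M = completion N"
    using assms by (auto simp: complete_borel_measure_def)
  have sp: "space N = UNIV" using sets_eq_imp_space_eq[OF N(1)] by simp
  show "sets borel \<subseteq> sets M" "space M = UNIV"
    using N sp by (auto simp flip: N(1))
  show "f \<in> borel_measurable M" if "f \<in> borel_measurable borel" for f
    using that N by (simp add: measurable_completion measurable_cong_sets[OF N(1) refl])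
  show "\<exists>g'. g' \<in> borel_measurable borel \<and> (\<forall>x. g x \<le> g' x) \<and> (AE x in M. g x = g' x)"
    if "g \<in> borel_measurable M" for g :: "_ \<Rightarrow> ennreal"
    using completion_borel_majorant[of g N] that N sp
    by (metis UNIV_I measurable_cong_sets)
qed

section \<open>From weak upper gradients to genuine ones\<close>

lemma e2ennreal_0 [simp]: "e2ennreal 0 = 0"
  by (simp add: zero_ennreal.abs_eq)

lemma e2ennreal_abs_diff_eq_0_iff:
  "e2ennreal \<bar>ereal a - ereal b\<bar> = 0 \<longleftrightarrow> a = b"
  by (simp add: ennreal_eq_0_iff flip: ennreal.rep_eq)

lemma borel_measurable_restrict_UNIV:
  "borel_measurable (restrict_space M UNIV) = borel_measurable M"
  by (intro measurable_cong_sets) (simp_all add: sets_restrict_space)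

text \<open>Finite energy concerns a weak upper gradient, whereas \<open>Dp\<close> asks for a
  genuine one. The maximum of a Borel majorant of \<open>g\<close> with a weight that is infinite
  along the exceptional curves satisfies the inequality on every curve and still has finite
  energy.\<close>

lemma p_weak_upper_gradient_imp_Dp:
  fixes M :: "'a::metric_space measure"
  assumes M: "complete_borel_measure M" and "0 < p" "u \<in> borel_measurable M"
    and g: "p_weak_upper_gradient M p u g" "(\<integral>\<^sup>+x. epow p (g x) \<partial>M) < \<infinity>"
  shows "u \<in> Dp M p"
proof -
  obtain \<Gamma> where gM: "g \<in> borel_measurable M" and \<Gamma>: "p_modulus M p \<Gamma> = 0"
    "\<And>\<gamma> l. arc_length_curve \<gamma> l \<Longrightarrow> (\<gamma>, l) \<notin> \<Gamma> \<Longrightarrow> upper_gradient_ineq u g \<gamma> l"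
    using g(1) unfolding p_weak_upper_gradient_def by blast
  obtain \<rho> where \<rho>: "\<rho> \<in> borel_measurable borel" "(\<integral>\<^sup>+x. epow p (\<rho> x) \<partial>M) \<le> ennreal 1"
    "\<And>\<gamma> l. (\<gamma>, l) \<in> \<Gamma> \<Longrightarrow> arc_length_curve \<gamma> l \<Longrightarrow> curve_integral \<rho> \<gamma> l = \<infinity>"
    using p_modulus_0_weight[OF complete_borel_measureD(1,2)[OF M] \<open>0 < p\<close> \<Gamma>(1) zero_less_one]
    by blast
  obtain g' where g': "g' \<in> borel_measurable borel" "\<And>x. g x \<le> g' x" "AE x in M. g x = g' x"
    using complete_borel_measureD(4)[OF M gM] by blast
  note [measurable] = g'(1) \<rho>(1) complete_borel_measureD(3)[OF M g'(1)]
    complete_borel_measureD(3)[OF M \<rho>(1)]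
  define G where "G x = max (g' x) (\<rho> x)" for x
  have "upper_gradient_ineq u G \<gamma> l" if c: "arc_length_curve \<gamma> l" for \<gamma> l
  proof (cases "(\<gamma>, l) \<in> \<Gamma>")
    case True
    have "curve_integral \<rho> \<gamma> l \<le> curve_integral G \<gamma> l"
      by (rule curve_integral_mono) (simp add: G_def)
    then show ?thesis
      using \<rho>(3)[OF True c] by (simp add: upper_gradient_ineq_def top_unique)
  next
    case False
    have "curve_integral g \<gamma> l \<le> curve_integral G \<gamma> l"
      by (rule curve_integral_mono) (simp add: G_def g'(2) max.coboundedI1)
    then show ?thesis
      using \<Gamma>(2)[OF c False] unfolding upper_gradient_ineq_def by (rule order_trans[rotated])
  qed
  moreover have "G \<in> borel_measurable borel"
    unfolding G_def by measurable
  ultimately have "upper_gradient_on UNIV u G"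
    by (simp add: upper_gradient_on_def borel_measurable_restrict_UNIV)
  moreover have "(\<integral>\<^sup>+x. epow p (G x) \<partial>M) < \<infinity>"
  proof -
    have "(\<integral>\<^sup>+x. epow p (G x) \<partial>M) \<le> (\<integral>\<^sup>+x. epow p (g' x) + epow p (\<rho> x) \<partial>M)"
      unfolding G_def using \<open>0 < p\<close> by (intro nn_integral_mono epow_max_le) auto
    also have "\<dots> = (\<integral>\<^sup>+x. epow p (g' x) \<partial>M) + (\<integral>\<^sup>+x. epow p (\<rho> x) \<partial>M)"
      by (rule nn_integral_add) measurable
    also have "(\<integral>\<^sup>+x. epow p (g' x) \<partial>M) = (\<integral>\<^sup>+x. epow p (g x) \<partial>M)"
      using g'(3) by (intro nn_integral_cong_AE) auto
    also have "\<dots> + (\<integral>\<^sup>+x. epow p (\<rho> x) \<partial>M) < \<infinity>"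
      using g(2) \<rho>(2) by (auto simp: less_top[symmetric] top_unique)
    finally show ?thesis .
  qed
  ultimately show ?thesis using assms(3) by (auto simp: Dp_def)
qed

section \<open>Upper gradients of arbitrarily small energy\<close>

text \<open>Only the pieces before the first and after the last visit to the level \<open>c\<close>
  matter: at both of these times the value is \<open>c\<close>, whatever happens in between. If the
  level is never visited, the whole curve is one such piece.\<close>

lemma level_set_curve_ends_eq:
  fixes u :: "'a::metric_space \<Rightarrow> real"
  assumes u: "continuous_on UNIV u" and \<gamma>: "arc_length_curve \<gamma> l"
    and seg: "\<And>a b. 0 \<le> a \<Longrightarrow> a < b \<Longrightarrow> b \<le> l \<Longrightarrow> (\<And>t. a < t \<Longrightarrow> t < b \<Longrightarrow> u (\<gamma> t) \<noteq> c)
      \<Longrightarrow> u (\<gamma> a) = u (\<gamma> b)"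
  shows "u (\<gamma> 0) = u (\<gamma> l)"
proof -
  have l: "0 < l" using \<gamma> by (simp add: arc_length_curve_def)
  define T where "T = {t \<in> {0..l}. u (\<gamma> t) = c}"
  have "continuous_on {0..l} (\<lambda>t. u (\<gamma> t))"
    by (rule continuous_on_compose2[OF u arc_length_curve_continuous_on[OF \<gamma>]]) auto
  then have "closed T"
    unfolding T_def by (intro continuous_closed_preimage_constant) auto
  have bdd: "bdd_below T" "bdd_above T"
    unfolding T_def by (auto intro: bdd_belowI[of _ 0] bdd_aboveI[of _ l])
  show ?thesis
  proof (cases "T = {}")
    case True
    then show ?thesis using l by (intro seg) (auto simp: T_def)
  next
    case False
    have I: "Inf T \<in> T" and S: "Sup T \<in> T"
      using closed_contains_Inf closed_contains_Sup False bdd \<open>closed T\<close> by auto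
    have "u (\<gamma> 0) = u (\<gamma> (Inf T))"
    \<comment> \<open>The piece degenerates when the curve starts on the level, whereas
      \<open>seg\<close> requires \<open>a < b\<close>.\<close>
    proof (cases "Inf T = 0")
      case False
      have "t \<notin> T" if "t < Inf T" for t
        using cInf_lower[OF _ bdd(1), of t] that by auto
      then show ?thesis using I False by (intro seg) (auto simp: T_def)
    qed simp
    moreover have "u (\<gamma> (Sup T)) = u (\<gamma> l)"
    proof (cases "Sup T = l")
      case False
      have "t \<notin> T" if "Sup T < t" for t
        using cSup_upper[OF _ bdd(2), of t] that by auto
      then show ?thesis using S False by (intro seg) (auto simp: T_def)
    qed simp
    ultimately show ?thesis using I S by (simp add: T_def)
  qed
qed

text \<open>End points are Lebesgue null. They must be left out because the pieces used below may
  touch the level \<open>c\<close> there, where \<open>g\<close> is not controlled.\<close>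

lemma curve_integral_mono_interior:
  assumes "\<And>t. 0 < t \<Longrightarrow> t < l \<Longrightarrow> f (\<gamma> t) \<le> g (\<gamma> t)"
  shows "curve_integral f \<gamma> l \<le> curve_integral g \<gamma> l"
proof -
  have ae: "AE t in lebesgue. t \<notin> {0, l}"
    by (rule AE_not_in) (auto intro: finite_imp_null_set_lborel null_sets_completionI)
  then have "AE t in lebesgue_on {0..l}. f (\<gamma> t) \<le> g (\<gamma> t)"
    by (subst AE_restrict_space_iff) (simp, rule eventually_mono[OF ae], auto intro!: assms simp: less_le)
  then show ?thesis unfolding curve_integral_def by (rule nn_integral_mono_AE)
qed

text \<open>A gradient vanishing a.e. on the space need not vanish a.e. along a given curve. The
  weight \<open>\<infinity> * h\<close> forces this along all curves of finite integral and costs no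
  energy, so only the weight for the exceptional family contributes, and its energy is at most
  \<open>\<epsilon>\<close>.\<close>

lemma ex_small_upper_gradient:
  fixes u :: "'a::metric_space \<Rightarrow> real"
  assumes M: "complete_borel_measure M" and "0 < p" and u: "continuous_on UNIV u"
    and g: "p_weak_upper_gradient M p (\<lambda>x. ereal (u x)) g"
    and g0: "AE x in M. u x \<noteq> c \<longrightarrow> g x = 0" and "0 < \<epsilon>"
  shows "\<exists>\<rho>. upper_gradient_on UNIV (\<lambda>x. ereal (u x)) \<rho> \<and> (\<integral>\<^sup>+x. epow p (\<rho> x) \<partial>M) \<le> ennreal \<epsilon>"
proof -
  obtain \<Gamma> where gM: "g \<in> borel_measurable M" and \<Gamma>: "p_modulus M p \<Gamma> = 0"
    "\<And>\<gamma> l. arc_length_curve \<gamma> l \<Longrightarrow> (\<gamma>, l) \<notin> \<Gamma> \<Longrightarrow> upper_gradient_ineq (\<lambda>x. ereal (u x)) g \<gamma> l"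
    using g unfolding p_weak_upper_gradient_def by blast
  obtain \<rho> where \<rho>: "\<rho> \<in> borel_measurable borel" "(\<integral>\<^sup>+x. epow p (\<rho> x) \<partial>M) \<le> ennreal \<epsilon>"
    "\<And>\<gamma> l. (\<gamma>, l) \<in> \<Gamma> \<Longrightarrow> arc_length_curve \<gamma> l \<Longrightarrow> curve_integral \<rho> \<gamma> l = \<infinity>"
    using p_modulus_0_weight[OF complete_borel_measureD(1,2)[OF M] \<open>0 < p\<close> \<Gamma>(1) \<open>0 < \<epsilon>\<close>]
    by blast
  have "open {x. u x \<noteq> c}"
    using u by (intro open_Collect_neq) auto
  then have [measurable]: "{x. u x \<noteq> c} \<in> sets M"
    using complete_borel_measureD(1)[OF M] by auto
  \<comment> \<open>The cut-off discards \<open>g\<close> on the level set, where nothing is known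
    about it; what remains is zero a.e., and so is its Borel majorant \<open>h\<close>.\<close>
  have "(\<lambda>x. g x * indicator {x. u x \<noteq> c} x) \<in> borel_measurable M"
    using gM by measurable
  then obtain h where h: "h \<in> borel_measurable borel"
      "\<And>x. g x * indicator {x. u x \<noteq> c} x \<le> h x"
      "AE x in M. g x * indicator {x. u x \<noteq> c} x = h x"
    using complete_borel_measureD(4)[OF M] by blast
  have h_ge: "g x \<le> h x" if "u x \<noteq> c" for x using h(2)[of x] that by simp
  have h0: "AE x in M. h x = 0"
    using h(3) g0 by eventually_elim (auto split: split_indicator_asm)
  note [measurable] = h(1) \<rho>(1)
  \<comment> \<open>If \<open>G\<close> is integrable along a curve, then \<open>h\<close> vanishes a.e. along it and no subcurve is in \<open>\<Gamma>\<close>.\<close>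
  define G where "G x = max (\<rho> x) (\<infinity> * h x)" for x
  have G: "G \<in> borel_measurable borel"
    unfolding G_def by measurable
  have "upper_gradient_ineq (\<lambda>x. ereal (u x)) G \<gamma> l" if c: "arc_length_curve \<gamma> l" for \<gamma> l
  proof (cases "curve_integral G \<gamma> l = \<infinity>")
    case True
    then show ?thesis by (simp add: upper_gradient_ineq_def)
  next
    case fin: False
    have "u (\<gamma> 0) = u (\<gamma> l)"
    proof (rule level_set_curve_ends_eq[OF u c])
      fix a b assume ab: "0 \<le> a" "a < b" "b \<le> l" and nc: "\<And>t. a < t \<Longrightarrow> t < b \<Longrightarrow> u (\<gamma> t) \<noteq> c"
      let ?\<gamma> = "\<lambda>r. \<gamma> (a + r)" and ?l = "b - a"
      have sub: "arc_length_curve ?\<gamma> ?l"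
        by (rule arc_length_curve_subcurve[OF c ab])
      have "curve_integral G ?\<gamma> ?l \<le> curve_integral G \<gamma> l"
        by (rule curve_integral_subcurve_le[OF c G ab])
      with fin have fin': "curve_integral G ?\<gamma> ?l \<noteq> \<infinity>"
        by (auto simp: top_unique)
      moreover have "curve_integral \<rho> ?\<gamma> ?l \<le> curve_integral G ?\<gamma> ?l"
        by (rule curve_integral_mono) (simp add: G_def)
      ultimately have "(?\<gamma>, ?l) \<notin> \<Gamma>"
        using \<rho>(3)[OF _ sub] by (auto simp: top_unique)
      then have "upper_gradient_ineq (\<lambda>x. ereal (u x)) g ?\<gamma> ?l"
        using \<Gamma>(2) sub by blast
      moreover have "curve_integral g ?\<gamma> ?l \<le> curve_integral h ?\<gamma> ?l"
        by (rule curve_integral_mono_interior) (simp add: h_ge nc)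
      moreover have "curve_integral h ?\<gamma> ?l = 0"
      proof -
        have "\<infinity> * curve_integral h ?\<gamma> ?l = curve_integral (\<lambda>x. \<infinity> * h x) ?\<gamma> ?l"
          unfolding curve_integral_def
          by (rule nn_integral_cmult[symmetric, OF borel_measurable_along_curve[OF sub h(1)]])
        also have "\<dots> \<le> curve_integral G ?\<gamma> ?l"
          by (rule curve_integral_mono) (simp add: G_def)
        finally show ?thesis using fin' by (auto simp: ennreal_top_mult top_unique split: if_splits)
      qed
      ultimately have "e2ennreal \<bar>ereal (u (\<gamma> a)) - ereal (u (\<gamma> b))\<bar> = 0"
        by (simp add: upper_gradient_ineq_def)
      then show "u (\<gamma> a) = u (\<gamma> b)" by (simp only: e2ennreal_abs_diff_eq_0_iff)
    qed
    then show ?thesis by (simp add: upper_gradient_ineq_def)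
  qed
  then have "upper_gradient_on UNIV (\<lambda>x. ereal (u x)) G"
    using G by (simp add: upper_gradient_on_def borel_measurable_restrict_UNIV)
  \<comment> \<open>Here \<open>\<infinity> * 0 = 0\<close>, so \<open>G\<close> agrees with
    \<open>\<rho>\<close> wherever \<open>h\<close> vanishes.\<close>
  moreover have "(\<integral>\<^sup>+x. epow p (G x) \<partial>M) = (\<integral>\<^sup>+x. epow p (\<rho> x) \<partial>M)"
    using h0 by (intro nn_integral_cong_AE) (auto simp: G_def max_def elim!: eventually_mono)
  ultimately show ?thesis using \<rho>(2) by auto
qed

section \<open>The Poincare inequality and local constancy\<close>

lemma ennreal_eq_0_if_le_all:
  fixes x :: ennreal
  assumes "\<And>e. 0 < e \<Longrightarrow> x \<le> ennreal e"
  shows "x = 0"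
  using ennreal_le_epsilon[of 0 x] assms by simp

lemma upper_gradient_on_subset:
  assumes "upper_gradient_on UNIV u g"
  shows "upper_gradient_on \<Omega> u g"
  using assms by (auto simp: upper_gradient_on_def borel_measurable_restrict_UNIV intro: measurable_restrict_space1)

text \<open>A deviation from \<open>c\<close> at \<open>z\<close> persists, by continuity, on a
  small ball around \<open>z\<close>, which has positive measure.\<close>

lemma continuous_eq_if_nn_integral_0:
  fixes u :: "'a::metric_space \<Rightarrow> real"
  assumes sets: "sets borel \<subseteq> sets M" and pos: "\<And>x r. 0 < r \<Longrightarrow> 0 < emeasure M (ball x r)"
    and u: "continuous_on UNIV u" and "open U" "z \<in> U"
    and int: "(\<integral>\<^sup>+y\<in>U. e2ennreal \<bar>ereal (u y) - ereal c\<bar> \<partial>M) = 0"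
  shows "u z = c"
proof (rule ccontr)
  assume "u z \<noteq> c"
  define d where "d = \<bar>u z - c\<bar> / 2"
  have d: "0 < d" using \<open>u z \<noteq> c\<close> by (simp add: d_def)
  have "open {y. d < \<bar>u y - c\<bar>}"
    using u by (intro open_Collect_less continuous_intros) auto
  then have "open (U \<inter> {y. d < \<bar>u y - c\<bar>})" using \<open>open U\<close> by blast
  moreover have "z \<in> U \<inter> {y. d < \<bar>u y - c\<bar>}" using \<open>z \<in> U\<close> d by (auto simp: d_def)
  ultimately obtain s where s: "0 < s" "ball z s \<subseteq> U \<inter> {y. d < \<bar>u y - c\<bar>}"
    by (meson openE)
  have "ennreal d * emeasure M (ball z s) = (\<integral>\<^sup>+y. ennreal d * indicator (ball z s) y \<partial>M)"
    using sets by (subst nn_integral_cmult_indicator) auto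
  also have "\<dots> \<le> (\<integral>\<^sup>+y\<in>U. e2ennreal \<bar>ereal (u y) - ereal c\<bar> \<partial>M)"
    using s(2) by (intro nn_integral_mono)
      (force split: split_indicator simp flip: ennreal.rep_eq intro!: ennreal_leI)
  finally show False using int pos[OF s(1), of z] d by (auto simp: ennreal_eq_0_iff)
qed

text \<open>Gradients of arbitrarily small energy force the mean oscillation on one fixed ball to be
  zero; continuity turns constancy a.e. into constancy everywhere on that ball.\<close>

lemma poincare_imp_locally_constant:
  fixes u :: "'a::metric_space \<Rightarrow> real"
  assumes M: "complete_borel_measure M" and "0 < p"
    and balls: "\<And>x r. 0 < r \<Longrightarrow> 0 < emeasure M (ball x r) \<and> emeasure M (ball x r) < \<infinity>"
    and u: "continuous_on UNIV u" and "0 < R" "poincare_within M p (ball x R)"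
    and small: "\<And>\<epsilon>. 0 < \<epsilon> \<Longrightarrow>
      \<exists>\<rho>. upper_gradient_on UNIV (\<lambda>x. ereal (u x)) \<rho> \<and> (\<integral>\<^sup>+x. epow p (\<rho> x) \<partial>M) \<le> ennreal \<epsilon>"
  shows "\<exists>r>0. \<exists>c. \<forall>y\<in>ball x r. u y = c"
proof -
  obtain C L where CL: "0 < C" "1 \<le> L" and
    poin: "\<And>y r v g. 0 < r \<Longrightarrow> ball y r \<subseteq> ball x R \<Longrightarrow>
        v \<in> borel_measurable (restrict_space M (ball y (L * r))) \<Longrightarrow>
        (\<integral>\<^sup>+z\<in>ball y (L * r). e2ennreal \<bar>v z\<bar> \<partial>M) < \<infinity> \<Longrightarrow>
        upper_gradient_on (ball y (L * r)) v g \<Longrightarrow>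
        (\<integral>\<^sup>+z\<in>ball y r. e2ennreal \<bar>v z - ereal ((LINT y:ball y r|M. real_of_ereal (v y)) / measure M (ball y r))\<bar> \<partial>M)
            / emeasure M (ball y r)
            \<le> ennreal (C * r) *
              epow (1 / p) ((\<integral>\<^sup>+z\<in>ball y (L * r). epow p (g z) \<partial>M) / emeasure M (ball y (L * r)))"
    using assms(6) unfolding poincare_within_def Let_def
    by (elim exE conjE) (rule that, assumption, assumption, blast)
  have "open {y. \<bar>u y - u x\<bar> < 1}"
    using u by (intro open_Collect_less continuous_intros) auto
  then obtain s where s: "0 < s" "ball x s \<subseteq> {y. \<bar>u y - u x\<bar> < 1}"
    using openE[of "{y. \<bar>u y - u x\<bar> < 1}" x] by auto
  \<comment> \<open>The bound \<open>R\<close> keeps the ball inside the region of validity of the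
    inequality; \<open>s / L\<close> keeps the dilated ball where \<open>u\<close> is within 1 of
    \<open>u x\<close>, hence bounded and integrable.\<close>
  define r where "r = min R (s / L)"
  have r: "0 < r" "ball x r \<subseteq> ball x R" "L * r \<le> s"
    using CL s \<open>0 < R\<close> mult_left_mono[of r "s / L" L] by (auto simp: r_def intro: subset_ball)
  define K where "K = \<bar>u x\<bar> + 1"
  have bound: "\<bar>u y\<bar> \<le> K" if "y \<in> ball x (L * r)" for y
  proof -
    have "y \<in> ball x s" using that r(3) by auto
    then have "\<bar>u y - u x\<bar> < 1" using s(2) by blast
    then show ?thesis unfolding K_def by linarith
  qed
  let ?B = "ball x r" and ?B' = "ball x (L * r)"
  have Lr: "0 < L * r" using CL r by simp
  have setsB: "ball y t \<in> sets M" for y :: 'a and t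
    using complete_borel_measureD(1)[OF M] by auto
  have meas: "(\<lambda>x. ereal (u x)) \<in> borel_measurable (restrict_space M ?B')"
    using borel_measurable_continuous_onI[OF u]
    by (intro measurable_restrict_space1 complete_borel_measureD(3)[OF M]) simp
  have "(\<integral>\<^sup>+y\<in>?B'. e2ennreal \<bar>ereal (u y)\<bar> \<partial>M) \<le> (\<integral>\<^sup>+y. ennreal K * indicator ?B' y \<partial>M)"
    using bound by (intro nn_integral_mono)
      (auto split: split_indicator simp flip: ennreal.rep_eq intro!: ennreal_leI)
  also have "\<dots> = ennreal K * emeasure M ?B'"
    using setsB by (rule nn_integral_cmult_indicator)
  also have "\<dots> < \<infinity>"
    using balls[OF Lr, of x] by (simp add: ennreal_mult_less_top)
  finally have int: "(\<integral>\<^sup>+y\<in>?B'. e2ennreal \<bar>ereal (u y)\<bar> \<partial>M) < \<infinity>" .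
  \<comment> \<open>The redundant conversions keep the mean in the form in which the Poincare
    inequality produces it.\<close>
  define c where "c = (LINT y:?B|M. real_of_ereal (ereal (u y))) / measure M ?B"
  let ?I = "\<integral>\<^sup>+y\<in>?B. e2ennreal \<bar>ereal (u y) - ereal c\<bar> \<partial>M"
  define m where "m = measure M ?B'"
  have m: "emeasure M ?B' = ennreal m" "0 < m"
    using balls[OF Lr, of x] unfolding m_def
    by (auto simp: emeasure_eq_ennreal_measure less_top[symmetric] zero_less_measure_iff)
  have "?I / emeasure M ?B \<le> ennreal e" if "0 < e" for e
  proof -
    \<comment> \<open>With this choice, energy at most \<open>\<delta> powr p * m\<close> gives a
      p-th mean of at most \<open>\<delta>\<close> over the dilated ball, and the right-hand side of
      the inequality is at most \<open>e\<close>.\<close>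
    define \<delta> where "\<delta> = e / (C * r)"
    have \<delta>: "0 < \<delta>" using that CL r by (simp add: \<delta>_def)
    obtain \<rho> where \<rho>: "upper_gradient_on UNIV (\<lambda>x. ereal (u x)) \<rho>"
      "(\<integral>\<^sup>+x. epow p (\<rho> x) \<partial>M) \<le> ennreal (\<delta> powr p * m)"
      using small[of "\<delta> powr p * m"] \<delta> m by auto
    have "(\<integral>\<^sup>+y\<in>?B'. epow p (\<rho> y) \<partial>M) \<le> (\<integral>\<^sup>+x. epow p (\<rho> x) \<partial>M)"
      by (intro nn_integral_mono) (auto split: split_indicator)
    then have "(\<integral>\<^sup>+y\<in>?B'. epow p (\<rho> y) \<partial>M) / emeasure M ?B' \<le> ennreal (\<delta> powr p * m) / ennreal m"
      using \<rho>(2) by (auto simp: m(1) intro!: divide_right_mono_ennreal)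
    also have "\<dots> = epow p (ennreal \<delta>)"
      using m \<delta> by (simp add: divide_ennreal epow_def)
    finally have "epow (1 / p) ((\<integral>\<^sup>+y\<in>?B'. epow p (\<rho> y) \<partial>M) / emeasure M ?B')
        \<le> epow (1 / p) (epow p (ennreal \<delta>))"
      using \<open>0 < p\<close> by (intro epow_mono) auto
    also have "\<dots> = ennreal \<delta>" using \<open>0 < p\<close> by (rule epow_inverse_epow)
    finally have "ennreal (C * r) * epow (1 / p) ((\<integral>\<^sup>+y\<in>?B'. epow p (\<rho> y) \<partial>M) / emeasure M ?B')
        \<le> ennreal (C * r) * ennreal \<delta>"
      by (intro mult_left_mono) auto
    also have "\<dots> = ennreal e"
      using CL r \<delta> by (subst ennreal_mult[symmetric]) (auto simp: \<delta>_def)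
    finally show ?thesis
      using poin[OF r(1,2) meas int upper_gradient_on_subset[OF \<rho>(1)]]
      unfolding c_def by (rule order_trans[rotated])
  qed
  then have "?I / emeasure M ?B = 0"
    by (rule ennreal_eq_0_if_le_all)
  \<comment> \<open>Finiteness of the measure of the ball is essential: a quotient by
    \<open>\<infinity>\<close> would be zero for any finite numerator.\<close>
  then have "?I = 0"
    using balls[OF r(1), of x] by auto
  then have "u y = c" if "y \<in> ?B" for y
    using continuous_eq_if_nn_integral_0[OF complete_borel_measureD(1)[OF M] _ u open_ball that] balls
    by blast
  then show ?thesis using r(1) by blast
qed

section \<open>The test function and the conclusion\<close>

lemma uminus_in_N1p:
  assumes "f \<in> N1p M p"
  shows "(\<lambda>x. - f x) \<in> N1p M p"
proof -
  have abs_eq: "\<bar>- a - - b\<bar> = \<bar>a - b\<bar>" for a b :: ereal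
    by (cases a; cases b) auto
  have "upper_gradient_on UNIV (\<lambda>x. - f x) = upper_gradient_on UNIV f"
    by (intro ext) (simp only: upper_gradient_on_def upper_gradient_ineq_def abs_eq)
  then show ?thesis using assms by (auto simp: N1p_on_def)
qed

text \<open>The empty family serves as the exceptional one, and minimality is clear because zero is
  the least gradient.\<close>

lemma minimal_p_weak_upper_gradient_const:
  "minimal_p_weak_upper_gradient M p (\<lambda>x. ereal c) (\<lambda>x. 0)"
proof -
  have "p_modulus M p {} \<le> (\<integral>\<^sup>+x. epow p 0 \<partial>M)"
    unfolding p_modulus_def by (rule INF_lower2[of "\<lambda>_. 0"]) auto
  then have "p_modulus M p {} = 0" by simp
  then show ?thesis
    unfolding minimal_p_weak_upper_gradient_def p_weak_upper_gradient_def Lp_loc_def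
    by (auto simp: upper_gradient_ineq_def intro!: exI[of _ "{}"] exI[of _ "1::real"])
qed

lemma p_harmonic_energy_le:
  assumes "p_harmonic M p u" "\<phi> \<in> N1p M p"
    "minimal_p_weak_upper_gradient M p (\<lambda>x. ereal (u x)) g"
    "minimal_p_weak_upper_gradient M p (\<lambda>x. ereal (u x) + \<phi> x) h"
  shows "(\<integral>\<^sup>+x\<in>{x. \<phi> x \<noteq> 0}. epow p (g x) \<partial>M) \<le> (\<integral>\<^sup>+x\<in>{x. \<phi> x \<noteq> 0}. epow p (h x) \<partial>M)"
  using assms unfolding p_harmonic_def by blast

theorem theorem1p4:
  fixes M :: "'a::metric_space measure" and p :: real
  assumes "1 < p"
    and "complete_borel_measure M"
    and "\<forall>x. \<forall>r>0. 0 < emeasure M (ball x r) \<and> emeasure M (ball x r) < \<infinity>"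
    and "\<not> bounded (UNIV :: 'a set)"
    and "proper_space TYPE('a)"
    and "connected (UNIV :: 'a set)"
    and "locally_doubling M"
    and "local_poincare M p"
    and "\<not> O_HD M p"
  shows "Dp M p \<noteq> {\<lambda>x. f x + ereal c | f c. f \<in> N1p M p}"
proof
  assume eq: "Dp M p = {\<lambda>x. f x + ereal c | f c. f \<in> N1p M p}"
  note M = assms(2)
  have p: "0 < p" using assms(1) by simp
  obtain u where harm: "p_harmonic M p u" and fin: "finite_energy M p u"
    and nonconst: "\<not> (\<exists>c. \<forall>x. u x = c)"
    using assms(9) by (auto simp: O_HD_def)
  have u: "continuous_on UNIV u" using harm by (simp add: p_harmonic_def)
  have uM: "(\<lambda>x. ereal (u x)) \<in> borel_measurable M"
    using borel_measurable_continuous_onI[OF u]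
    by (intro complete_borel_measureD(3)[OF M]) simp
  obtain g where g: "minimal_p_weak_upper_gradient M p (\<lambda>x. ereal (u x)) g"
    "(\<integral>\<^sup>+x. epow p (g x) \<partial>M) < \<infinity>"
    using fin by (auto simp: finite_energy_def)
  have wg: "p_weak_upper_gradient M p (\<lambda>x. ereal (u x)) g"
    using g(1) by (simp add: minimal_p_weak_upper_gradient_def)
  then have gM [measurable]: "g \<in> borel_measurable M"
    by (simp add: p_weak_upper_gradient_def)
  obtain f c where f: "f \<in> N1p M p" and ufc: "(\<lambda>x. ereal (u x)) = (\<lambda>x. f x + ereal c)"
    using p_weak_upper_gradient_imp_Dp[OF M p uM wg g(2)] eq by auto
  \<comment> \<open>Since \<open>u\<close> is real-valued, \<open>f\<close> cannot take infinite
    values.\<close>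
  have fu: "f x = ereal (u x - c)" for x
    using fun_cong[OF ufc, of x] by (cases "f x") auto
  define \<phi> where "\<phi> x = - f x" for x
  have "\<phi> \<in> N1p M p" unfolding \<phi>_def using f by (rule uminus_in_N1p)
  moreover have "(\<lambda>x. ereal (u x) + \<phi> x) = (\<lambda>x. ereal c)"
    by (simp add: \<phi>_def fu)
  ultimately have "(\<integral>\<^sup>+x\<in>{x. \<phi> x \<noteq> 0}. epow p (g x) \<partial>M) \<le> (\<integral>\<^sup>+x\<in>{x. \<phi> x \<noteq> 0}. epow p 0 \<partial>M)"
    using minimal_p_weak_upper_gradient_const[of M p c]
    by (intro p_harmonic_energy_le[OF harm _ g(1)]) simp_all
  moreover have phi_ne: "{x. \<phi> x \<noteq> 0} = {x. u x \<noteq> c}"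
    by (auto simp: \<phi>_def fu)
  ultimately have int0: "(\<integral>\<^sup>+x\<in>{x. u x \<noteq> c}. epow p (g x) \<partial>M) = 0" by simp
  have "open {x. u x \<noteq> c}"
    using u by (intro open_Collect_neq) auto
  then have [measurable]: "{x. u x \<noteq> c} \<in> sets M"
    using complete_borel_measureD(1)[OF M] by auto
  have "AE x in M. epow p (g x) * indicator {x. u x \<noteq> c} x = 0"
    using int0 by (subst (asm) nn_integral_0_iff_AE) auto
  then have g0: "AE x in M. u x \<noteq> c \<longrightarrow> g x = 0"
    by eventually_elim (auto simp: epow_eq_0_iff[OF p])
  \<comment> \<open>The bound \<open>c\<close> depends on \<open>x\<close> and is not the level
    \<open>c\<close> fixed above.\<close>
  have loc: "\<exists>r>0. \<exists>c. \<forall>y\<in>ball x r. u y = c" for x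
  proof -
    obtain R where R: "0 < R" "poincare_within M p (ball x R)"
      using assms(8) by (auto simp: local_poincare_def)
    show ?thesis
      using assms(3)
      by (intro poincare_imp_locally_constant[OF M p _ u R]
          ex_small_upper_gradient[OF M p u wg g0]) auto
  qed
  \<comment> \<open>Local constancy is restated in filter form, from which connectedness yields a
    global constant.\<close>
  have "eventually (\<lambda>y. u x = u y) (at x within UNIV)" for x
  proof -
    obtain r where "0 < r" "\<And>y. y \<in> ball x r \<Longrightarrow> u x = u y"
      using loc[of x] by (metis centre_in_ball)
    then show ?thesis by (auto simp: eventually_at dist_commute intro!: exI[of _ r])
  qed
  then have "u x = u y" for x y
    by (intro connected_local_const[OF assms(6)]) auto
  then show False using nonconst by blast
qed

end
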